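(* Let $n$ be a positive integer and let $Q_{4n}=\langle a,b : a^{2n}=e,\ a^n=b^2,\ bab^{-1}=a^{-1}\rangle$ be the generalized quaternion group of order $4n$. Then $$W(\mathrm{ESCom}(Q_{4n}))=14n^2-8n.$$
   Context: All graphs are simple and undirected. For a finite group $G$, the equality supercommuting graph $\mathrm{ESCom}(G)$ is the commuting graph of $G$: its vertex set is $G$ (all elements), and distinct $g,h\in G$ are adjacent if and only if $gh=hg$. The Wiener index $W(\Gamma)$ of a connected graph $\Gamma$ is the sum of the distances $d_\Gamma(u,v)$ (lengths of shortest paths) over all unordered pairs of distinct vertices $u,v$ of $\Gamma$. *)

theory Defs
  imports "HOL-Algebra.Group" "Graph_Theory.Graph_Theory"
begin

section \<open>Groups given by generators and relations\<close>

text \<open>A word over the alphabet \<open>'x\<close> of generators is a list of letters; the letter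
  \<open>(x, True)\<close> stands for the generator \<open>x\<close> and \<open>(x, False)\<close> for its formal inverse. Relations
  are pairs of words.\<close>

type_synonym 'x gword = "('x \<times> bool) list"

inductive pres_eq :: "('x gword \<times> 'x gword) set \<Rightarrow> 'x gword \<Rightarrow> 'x gword \<Rightarrow> bool"
  for R :: "('x gword \<times> 'x gword) set"
where
  rel: "(u, v) \<in> R \<Longrightarrow> pres_eq R u v"
| cancel: "pres_eq R [(x, s), (x, \<not> s)] []"
| refl: "pres_eq R u u"
| sym: "pres_eq R u v \<Longrightarrow> pres_eq R v u"
| trans: "pres_eq R u v \<Longrightarrow> pres_eq R v w \<Longrightarrow> pres_eq R u w"
| append: "pres_eq R u u' \<Longrightarrow> pres_eq R v v' \<Longrightarrow> pres_eq R (u @ v) (u' @ v')"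

definition pres_class :: "('x gword \<times> 'x gword) set \<Rightarrow> 'x gword \<Rightarrow> 'x gword set" where
  "pres_class R u = {v. pres_eq R u v}"

text \<open>The group with generators all elements of the type \<open>'x\<close> and defining relations \<open>R\<close>.\<close>

definition presented_group :: "('x gword \<times> 'x gword) set \<Rightarrow> 'x gword set monoid" where
  "presented_group R =
    \<lparr> carrier = range (pres_class R),
      monoid.mult = (\<lambda>A B. {w. \<exists>u\<in>A. \<exists>v\<in>B. pres_eq R (u @ v) w}),
      one = pres_class R [] \<rparr>"

lemma pres_class_eq_iff: "pres_class R u = pres_class R v \<longleftrightarrow> pres_eq R u v"
  unfolding pres_class_def by (blast intro: pres_eq.refl pres_eq.sym pres_eq.trans)

lemma carrier_presented_group: "carrier (presented_group R) = range (pres_class R)"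
  by (simp add: presented_group_def)

lemma one_presented_group: "\<one>\<^bsub>presented_group R\<^esub> = pres_class R []"
  by (simp add: presented_group_def)

lemma mult_presented_group:
  "pres_class R u \<otimes>\<^bsub>presented_group R\<^esub> pres_class R v = pres_class R (u @ v)"
  unfolding presented_group_def pres_class_def
  by (auto intro: pres_eq.refl pres_eq.trans pres_eq.append)

lemma pres_eq_left_inverse: "\<exists>v. pres_eq R (v @ u) []"
proof (induction u)
  case Nil
  show ?case by (metis append_Nil pres_eq.refl)
next
  case (Cons l u)
  obtain x s where l: "l = (x, s)" by (cases l)
  from Cons.IH obtain v where v: "pres_eq R (v @ u) []" ..
  have "pres_eq R [(x, \<not> s), (x, s)] []" using pres_eq.cancel[of R x "\<not> s"] by simp
  then have "pres_eq R (v @ ([(x, \<not> s), (x, s)] @ u)) (v @ ([] @ u))"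
    by (intro pres_eq.append pres_eq.refl)
  then have "pres_eq R ((v @ [(x, \<not> s)]) @ (l # u)) []"
    using v l by (auto intro: pres_eq.trans)
  then show ?case ..
qed

lemma group_presented_group: "group (presented_group R)"
proof (rule groupI)
  fix A assume "A \<in> carrier (presented_group R)"
  then obtain u where u: "A = pres_class R u" by (auto simp: carrier_presented_group)
  obtain v where "pres_eq R (v @ u) []" using pres_eq_left_inverse by blast
  then show "\<exists>B\<in>carrier (presented_group R). B \<otimes>\<^bsub>presented_group R\<^esub> A = \<one>\<^bsub>presented_group R\<^esub>"
    by (auto simp: carrier_presented_group one_presented_group u mult_presented_group
        pres_class_eq_iff)
qed (auto simp: carrier_presented_group one_presented_group mult_presented_group)


section \<open>The generalized quaternion group\<close>

datatype quat_gen = Gen_a | Gen_b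

text \<open>The relations \<open>a ^ (2n) = e\<close>, \<open>a ^ n = b ^ 2\<close> and \<open>b a b\<^sup>-\<^sup>1 = a\<^sup>-\<^sup>1\<close>.\<close>

definition quaternion_relations :: "nat \<Rightarrow> (quat_gen gword \<times> quat_gen gword) set" where
  "quaternion_relations n =
    { (replicate (2 * n) (Gen_a, True), []),
      (replicate n (Gen_a, True), [(Gen_b, True), (Gen_b, True)]),
      ([(Gen_b, True), (Gen_a, True), (Gen_b, False)], [(Gen_a, False)]) }"

definition generalized_quaternion :: "nat \<Rightarrow> quat_gen gword set monoid" where
  "generalized_quaternion n = presented_group (quaternion_relations n)"


section \<open>Commuting graph and Wiener index\<close>

text \<open>A simple undirected graph is represented by the symmetric, loop-free set of its arcs,
  see \<^locale>\<open>pair_graph\<close>.\<close>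

definition ESCom :: "('a, 'm) monoid_scheme \<Rightarrow> 'a pair_pre_digraph" where
  "ESCom G =
    \<lparr> pverts = carrier G,
      parcs = {(g, h). g \<in> carrier G \<and> h \<in> carrier G \<and> g \<noteq> h \<and> g \<otimes>\<^bsub>G\<^esub> h = h \<otimes>\<^bsub>G\<^esub> g} \<rparr>"

lemma pair_graph_ESCom:
  assumes "finite (carrier G)"
  shows "pair_graph (ESCom G)"
proof
  show "finite (parcs (ESCom G))"
    by (rule finite_subset[of _ "carrier G \<times> carrier G"]) (use assms in \<open>auto simp: ESCom_def\<close>)
  show "symmetric (with_proj (ESCom G))"
    by (auto simp: symmetric_def sym_def ESCom_def)
qed (use assms in \<open>auto simp: ESCom_def\<close>)

text \<open>The number of edges of a shortest walk (\<open>\<infinity>\<close> if there is none): every arc has weight 1.\<close>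

definition graph_dist :: "'a pair_pre_digraph \<Rightarrow> 'a \<Rightarrow> 'a \<Rightarrow> ereal" where
  "graph_dist \<Gamma> u v = wf_digraph.\<mu> (with_proj \<Gamma>) (\<lambda>_. 1) u v"

text \<open>The sum runs over the two-element sets of vertices. The value picked by \<open>THE\<close> is
  well defined because the distance in an undirected graph is symmetric.\<close>

definition wiener_index :: "'a pair_pre_digraph \<Rightarrow> ereal" where
  "wiener_index \<Gamma> =
    (\<Sum>e | e \<subseteq> pverts \<Gamma> \<and> card e = 2. THE d. \<exists>u v. e = {u, v} \<and> d = graph_dist \<Gamma> u v)"

end

theory Submission
  imports Defs
begin

text \<open>In a commuting graph the identity is adjacent to everything, so distances are 1 or 2 and
  the Wiener index of a finite group of order \<open>m\<close> with \<open>c\<close> ordered commuting pairs is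
  \<open>m\<^sup>2 - (m + c) / 2\<close>. For the presented group, the letters act on the \<open>4n\<close> formal normal forms
  \<open>a\<^sup>i b\<^sup>s\<close> compatibly with the relations, which shows that distinct normal forms are
  distinct elements; commutation of normal forms becomes a congruence modulo \<open>n\<close>, and
  \<open>c = 4n\<^sup>2 + 12n\<close>.\<close>

section \<open>The Wiener index of a commuting graph\<close>

lemma graph_dist_ESCom:
  assumes "group G" "finite (carrier G)" "u \<in> carrier G" "v \<in> carrier G" "u \<noteq> v"
  shows "graph_dist (ESCom G) u v = ereal (if u \<otimes>\<^bsub>G\<^esub> v = v \<otimes>\<^bsub>G\<^esub> u then 1 else 2)"
proof -
  interpret group G by fact
  interpret pair_graph "ESCom G" by (rule pair_graph_ESCom) fact
  have arc_iff: "(x, y) \<in> parcs (ESCom G) \<longleftrightarrow>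
      x \<in> carrier G \<and> y \<in> carrier G \<and> x \<noteq> y \<and> x \<otimes>\<^bsub>G\<^esub> y = y \<otimes>\<^bsub>G\<^esub> x" for x y
    by (simp add: ESCom_def)
  have verts: "pverts (ESCom G) = carrier G"
    by (simp add: ESCom_def)
  have cost: "awalk_cost (\<lambda>_. 1) p = real (length p)" for p :: "('a \<times> 'a) list"
    by (induction p) auto
  show ?thesis
  proof (cases "u \<otimes>\<^bsub>G\<^esub> v = v \<otimes>\<^bsub>G\<^esub> u")
    case True
    have "\<mu> (\<lambda>_. 1) u v = 1"
      unfolding \<mu>_def
    proof (rule INF_eqI)
      fix p assume "p \<in> {p. awalk u p v}"
      then have "length p \<ge> 1"
        using \<open>u \<noteq> v\<close> by (cases p) (auto simp: awalk_Nil_iff)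
      then show "1 \<le> ereal (awalk_cost (\<lambda>_. 1) p)"
        by (simp add: cost)
    next
      fix y :: ereal
      assume y: "\<And>p. p \<in> {p. awalk u p v} \<Longrightarrow> y \<le> ereal (awalk_cost (\<lambda>_. 1) p)"
      have "awalk u [(u, v)] v"
        using assms True by (simp add: awalk_Cons_iff awalk_Nil_iff arc_iff verts)
      then show "y \<le> 1" using y[of "[(u, v)]"] by (simp add: cost one_ereal_def)
    qed
    then show ?thesis using True by (simp add: graph_dist_def)
  next
    case False
    then have "u \<noteq> \<one>\<^bsub>G\<^esub>" "v \<noteq> \<one>\<^bsub>G\<^esub>" using assms by auto
    have "\<mu> (\<lambda>_. 1) u v = 2"
      unfolding \<mu>_def
    proof (rule INF_eqI)
      fix p assume "p \<in> {p. awalk u p v}"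
      \<comment> \<open>An empty walk would give \<open>u = v\<close>, and a single arc would make
        \<open>u\<close> and \<open>v\<close> commute.\<close>
      then have "length p \<ge> 2"
        using \<open>u \<noteq> v\<close> False
        by (cases p; cases "tl p") (auto simp: awalk_Nil_iff awalk_Cons_iff arc_iff)
      then show "2 \<le> ereal (awalk_cost (\<lambda>_. 1) p)"
        by (simp add: cost)
    next
      fix y :: ereal
      assume y: "\<And>p. p \<in> {p. awalk u p v} \<Longrightarrow> y \<le> ereal (awalk_cost (\<lambda>_. 1) p)"
      \<comment> \<open>The detour through the identity attains the bound; its two arcs are not
        loops because neither endpoint is the identity.\<close>
      have "awalk u [(u, \<one>\<^bsub>G\<^esub>), (\<one>\<^bsub>G\<^esub>, v)] v"
        using assms \<open>u \<noteq> \<one>\<^bsub>G\<^esub>\<close> \<open>v \<noteq> \<one>\<^bsub>G\<^esub>\<close>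
        by (auto simp: awalk_Cons_iff awalk_Nil_iff arc_iff verts)
      then show "y \<le> 2" using y[of "[(u, \<one>\<^bsub>G\<^esub>), (\<one>\<^bsub>G\<^esub>, v)]"] by (simp add: cost)
    qed
    then show ?thesis using False by (simp add: graph_dist_def)
  qed
qed

text \<open>Double counting: the fibre of \<open>(x, y)\<close> to \<open>{x, y}\<close> over a
  two-element set consists of two ordered pairs. This moves the sum to ordered pairs, where
  commutation is counted.\<close>

lemma sum_ordered_pairs_eq_twice_sum_subsets:
  fixes f :: "'a set \<Rightarrow> real"
  assumes "finite A"
  shows "(\<Sum>p | p \<in> A \<times> A \<and> fst p \<noteq> snd p. f {fst p, snd p})
    = 2 * (\<Sum>e | e \<subseteq> A \<and> card e = 2. f e)"
proof -
  let ?P = "{p. p \<in> A \<times> A \<and> fst p \<noteq> snd p}" and ?T = "{e. e \<subseteq> A \<and> card e = 2}"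
  let ?g = "\<lambda>p. {fst p, snd p}"
  have "(\<Sum>p\<in>?P. f (?g p)) = (\<Sum>e\<in>?T. \<Sum>p | p \<in> ?P \<and> ?g p = e. f (?g p))"
    by (rule sum.group[symmetric])
      (use assms in \<open>auto intro!: rev_finite_subset[OF finite_cartesian_product[OF assms assms]]\<close>)
  also have "\<dots> = (\<Sum>e\<in>?T. 2 * f e)"
  proof (rule sum.cong)
    fix e assume "e \<in> ?T"
    then obtain x y where e: "e = {x, y}" "x \<noteq> y" "x \<in> A" "y \<in> A"
      by (auto simp: card_2_iff)
    then have "{p. p \<in> ?P \<and> ?g p = e} = {(x, y), (y, x)}"
      by (auto simp: doubleton_eq_iff)
    then show "(\<Sum>p | p \<in> ?P \<and> ?g p = e. f (?g p)) = 2 * f e"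
      using e by (simp add: insert_commute)
  qed simp
  finally show ?thesis by (simp add: sum_distrib_left)
qed

text \<open>Let \<open>m\<close> be the order. The \<open>m^2 - m\<close> ordered pairs of distinct
  elements contribute 2 each, minus 1 for each of the \<open>c - m\<close> commuting ones among
  them; half of that total is the claim.\<close>

lemma wiener_index_ESCom:
  assumes "group G" "finite (carrier G)"
  defines "c \<equiv> card {(x, y). x \<in> carrier G \<and> y \<in> carrier G \<and> x \<otimes>\<^bsub>G\<^esub> y = y \<otimes>\<^bsub>G\<^esub> x}"
  shows "wiener_index (ESCom G) =
    ereal (real (card (carrier G)) ^ 2 - (real (card (carrier G)) + real c) / 2)"
proof -
  interpret group G by fact
  let ?A = "carrier G" and ?comm = "\<lambda>x y. x \<otimes>\<^bsub>G\<^esub> y = y \<otimes>\<^bsub>G\<^esub> x"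
  let ?C = "{(x, y). x \<in> ?A \<and> y \<in> ?A \<and> ?comm x y}"
  let ?P = "{p. p \<in> ?A \<times> ?A \<and> fst p \<noteq> snd p}"
  have finP: "finite ?P"
    by (auto intro!: rev_finite_subset[OF finite_cartesian_product[OF assms(2,2)]])
  \<comment> \<open>Every diagonal pair commutes, so removing the diagonal costs
    \<open>card ?A\<close> both in the square and in \<open>?C\<close>.\<close>
  have fin_diag: "finite (Id_on ?A)" and card_diag: "card (Id_on ?A) = card ?A"
    using assms(2) card_image[of "\<lambda>x. (x, x)" ?A]
    by (auto simp: Id_on_def inj_on_def UNION_singleton_eq_range)
  have "card (?P \<union> Id_on ?A) = card ?P + card (Id_on ?A)"
    by (rule card_Un_disjoint) (use finP fin_diag in auto)
  moreover have "?P \<union> Id_on ?A = ?A \<times> ?A" by auto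
  ultimately have cardP: "real (card ?P) + real (card ?A) = real (card ?A) ^ 2"
    by (simp add: card_diag card_cartesian_product power2_eq_square flip: of_nat_add of_nat_mult)
  have "card ((?P \<inter> ?C) \<union> Id_on ?A) = card (?P \<inter> ?C) + card (Id_on ?A)"
    by (rule card_Un_disjoint) (use finP fin_diag in auto)
  moreover have "(?P \<inter> ?C) \<union> Id_on ?A = ?C" by auto
  ultimately have cardC: "real (card (?P \<inter> ?C)) + real (card ?A) = real c"
    by (simp add: card_diag c_def flip: of_nat_add)
  \<comment> \<open>The distance is phrased as a function of the set \<open>e\<close>, with no order
    on its two elements, so that the \<open>THE\<close> in \<open>wiener_index\<close> has a unique
    value.\<close>
  define f where "f e = (if \<forall>x\<in>e. \<forall>y\<in>e. ?comm x y then 1 else 2 :: real)" for e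
  have f_pair: "f {u, v} = (if ?comm u v then 1 else 2)" for u v
  proof -
    have "(\<forall>x\<in>{u, v}. \<forall>y\<in>{u, v}. ?comm x y) \<longleftrightarrow> ?comm u v" by (metis insert_iff singletonD)
    then show ?thesis by (simp only: f_def)
  qed
  have "wiener_index (ESCom G) = (\<Sum>e | e \<subseteq> ?A \<and> card e = 2. ereal (f e))"
    unfolding wiener_index_def
  proof (rule sum.cong)
    fix e assume "e \<in> {e. e \<subseteq> ?A \<and> card e = 2}"
    then obtain x y where e: "e = {x, y}" "x \<noteq> y" "x \<in> ?A" "y \<in> ?A"
      by (auto simp: card_2_iff)
    have d: "graph_dist (ESCom G) u v = ereal (f e)" if "e = {u, v}" for u v
    proof -
      have "u \<in> ?A" "v \<in> ?A" "u \<noteq> v" using that e by (auto simp: doubleton_eq_iff)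
      then show ?thesis
        unfolding that f_pair by (rule graph_dist_ESCom[OF assms(1,2)])
    qed
    show "(THE d. \<exists>u v. e = {u, v} \<and> d = graph_dist (ESCom G) u v) = ereal (f e)"
      by (rule the_equality) (use d e(1) in \<open>auto, metis\<close>)
  qed (simp add: ESCom_def)
  also have "\<dots> = ereal (\<Sum>e | e \<subseteq> ?A \<and> card e = 2. f e)"
    by simp
  also have "(\<Sum>e | e \<subseteq> ?A \<and> card e = 2. f e) = (\<Sum>p\<in>?P. f {fst p, snd p}) / 2"
    using sum_ordered_pairs_eq_twice_sum_subsets[OF assms(2), of f] by simp
  also have "(\<Sum>p\<in>?P. f {fst p, snd p}) = (\<Sum>p\<in>?P. 2 - of_bool (p \<in> ?C))"
    by (rule sum.cong) (simp_all add: f_pair mem_Times_iff split_beta)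
  also have "\<dots> = 2 * real (card ?P) - real (card (?P \<inter> ?C))"
  proof -
    have "(\<Sum>p\<in>S. of_bool (p \<in> T)) = real (card (S \<inter> T))" if "finite S" for S T :: "('a \<times> 'a) set"
      using that by simp
    from this[OF finP] show ?thesis by (simp only: sum_subtractf sum_constant)
  qed
  also have "\<dots> / 2 = real (card ?A) ^ 2 - (real (card ?A) + real c) / 2"
    using cardP cardC by (simp add: field_simps)
  finally show ?thesis .
qed

section \<open>A normal form for the generalized quaternion group\<close>

text \<open>The pair \<open>(i, s)\<close> with \<open>0 \<le> i < 2n\<close> stands for \<open>a\<^sup>i b\<^sup>s\<close>; the function below
  describes left multiplication by a letter on these normal forms.\<close>

definition quat_forms :: "nat \<Rightarrow> (int \<times> bool) set" where
  "quat_forms n = {0..<2 * int n} \<times> UNIV"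

text \<open>The clauses for \<open>b\<close> encode \<open>b a^i = a^(-i) b\<close>,
  \<open>b^2 = a^n\<close> and \<open>b^(-1) = a^n b\<close>.\<close>

fun quat_act :: "nat \<Rightarrow> quat_gen \<times> bool \<Rightarrow> int \<times> bool \<Rightarrow> int \<times> bool" where
  "quat_act n (Gen_a, True) (i, s) = ((i + 1) mod (2 * int n), s)"
| "quat_act n (Gen_a, False) (i, s) = ((i - 1) mod (2 * int n), s)"
| "quat_act n (Gen_b, True) (i, False) = (- i mod (2 * int n), True)"
| "quat_act n (Gen_b, True) (i, True) = ((int n - i) mod (2 * int n), False)"
| "quat_act n (Gen_b, False) (i, False) = ((int n - i) mod (2 * int n), True)"
| "quat_act n (Gen_b, False) (i, True) = (- i mod (2 * int n), False)"

definition quat_word :: "int \<times> bool \<Rightarrow> quat_gen gword" where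
  "quat_word m = replicate (nat (fst m)) (Gen_a, True) @ (if snd m then [(Gen_b, True)] else [])"

definition quat_eval :: "nat \<Rightarrow> quat_gen gword \<Rightarrow> int \<times> bool \<Rightarrow> int \<times> bool" where
  "quat_eval n u = foldr (quat_act n) u"

lemma quat_eval_simps [simp]:
  "quat_eval n [] m = m"
  "quat_eval n (l # u) m = quat_act n l (quat_eval n u m)"
  "quat_eval n (u @ v) m = quat_eval n u (quat_eval n v m)"
  by (simp_all add: quat_eval_def)

section \<open>Words act on the normal forms, compatibly with the relations\<close>

lemma quat_act_in_forms:
  assumes "n > 0"
  shows "quat_act n l m \<in> quat_forms n"
  using assms by (cases "(n, l, m)" rule: quat_act.cases) (auto simp: quat_forms_def)

lemma quat_eval_in_forms: "n > 0 \<Longrightarrow> m \<in> quat_forms n \<Longrightarrow> quat_eval n u m \<in> quat_forms n"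
  by (induction u) (auto simp: quat_act_in_forms)

text \<open>Acting twice leaves the exponent reduced modulo \<open>2n\<close>, which gives back
  \<open>m\<close> because its exponent is already in range.\<close>

lemma quat_act_cancel:
  assumes "m \<in> quat_forms n"
  shows "quat_act n (x, s) (quat_act n (x, \<not> s) m) = m"
proof -
  obtain i t where m: "m = (i, t)" "0 \<le> i" "i < 2 * int n"
    using assms by (auto simp: quat_forms_def)
  show ?thesis
    using m by (cases x; cases s; cases t) (simp_all add: mod_simps)
qed

lemma quat_eval_replicate:
  "n > 0 \<Longrightarrow> (i, s) \<in> quat_forms n \<Longrightarrow>
    quat_eval n (replicate k (Gen_a, True)) (i, s) = ((int k + i) mod (2 * int n), s)"
  by (induction k) (auto simp: quat_forms_def mod_simps algebra_simps)

lemma quat_eval_rel: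
  assumes "n > 0" "(u, v) \<in> quaternion_relations n" "m \<in> quat_forms n"
  shows "quat_eval n u m = quat_eval n v m"
proof -
  obtain i t where m: "m = (i, t)" "0 \<le> i" "i < 2 * int n"
    using assms by (auto simp: quat_forms_def)
  have "(int n - (- i mod (2 * int n))) mod (2 * int n) = (int n + i) mod (2 * int n)"
    "(- ((int n - i) mod (2 * int n))) mod (2 * int n) = (i - int n) mod (2 * int n)"
    by (simp_all add: mod_simps)
  \<comment> \<open>Shifts by \<open>n\<close> and by \<open>-n\<close> agree modulo
    \<open>2n\<close>; this is what makes \<open>b^2\<close> act as \<open>a^n\<close> on the forms
    containing \<open>b\<close>.\<close>
  moreover have "(i - int n) mod (2 * int n) = (int n + i) mod (2 * int n)"
    by (simp add: mod_eq_dvd_iff)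
  ultimately show ?thesis
    using assms m
    by (cases t) (auto simp: quaternion_relations_def quat_eval_replicate mod_simps algebra_simps)
qed

text \<open>The action descends to the presented group. In the induction \<open>m\<close> must vary:
  for a concatenation, the left factor acts on a form already moved by the right one.\<close>

lemma pres_eq_imp_quat_eval_eq:
  assumes "n > 0" "pres_eq (quaternion_relations n) u v" "m \<in> quat_forms n"
  shows "quat_eval n u m = quat_eval n v m"
  using assms(2,3)
  by (induction arbitrary: m)
    (use assms(1) in \<open>auto simp: quat_eval_rel quat_eval_in_forms quat_act_cancel\<close>)

text \<open>This is the multiplication table: moving \<open>b\<close> past \<open>a^j\<close>
  negates \<open>j\<close>, and \<open>b^2\<close> contributes the shift by
  \<open>n\<close>.\<close>

lemma quat_eval_quat_word:
  assumes "n > 0" "(i, s) \<in> quat_forms n" "(j, t) \<in> quat_forms n"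
  shows "quat_eval n (quat_word (i, s)) (j, t) =
    (if s then if t then ((i + int n - j) mod (2 * int n), False)
               else ((i - j) mod (2 * int n), True)
     else ((i + j) mod (2 * int n), t))"
  using assms
  by (cases t)
    (auto simp: quat_word_def quat_forms_def quat_eval_replicate mod_simps algebra_simps)

lemma quat_eval_quat_word_one:
  assumes "n > 0" "m \<in> quat_forms n"
  shows "quat_eval n (quat_word m) (0, False) = m"
  using assms quat_eval_quat_word[of n "fst m" "snd m" 0 False]
  by (auto simp: quat_forms_def)

text \<open>Conversely, each step of the action is a consequence of the relations. The letter
  \<open>b\<close> comes after both letters of \<open>a\<close>, since moving it past a power of
  \<open>a\<close> produces inverse letters.\<close>

lemma pres_eq_quat_word_act:
  assumes n: "n > 0" and m: "m \<in> quat_forms n"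
  shows "pres_eq (quaternion_relations n) (l # quat_word m) (quat_word (quat_act n l m))"
proof -
  let ?E = "pres_eq (quaternion_relations n)"
  txt \<open>The two letters of a generator act by mutually inverse maps, so it suffices to treat one
    of them.\<close>
  have inverse_letter: "?E ((x, \<not> s) # quat_word m) (quat_word (quat_act n (x, \<not> s) m))"
    if "\<And>m. m \<in> quat_forms n \<Longrightarrow> ?E ((x, s) # quat_word m) (quat_word (quat_act n (x, s) m))"
      "m \<in> quat_forms n" for x s m
  proof -
    let ?m = "quat_act n (x, \<not> s) m"
    have "?E ((x, s) # quat_word ?m) (quat_word m)"
      using that(1)[of ?m] quat_act_cancel[OF that(2), of x s] n
      by (simp add: quat_act_in_forms)
    from pres_eq.append[OF pres_eq.refl[of _ "[(x, \<not> s)]"] this]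
    have "?E ((x, \<not> s) # (x, s) # quat_word ?m) ((x, \<not> s) # quat_word m)" by simp
    moreover have "?E ((x, \<not> s) # (x, s) # quat_word ?m) (quat_word ?m)"
      using pres_eq.append[OF pres_eq.cancel[of _ x "\<not> s"] pres_eq.refl[of _ "quat_word ?m"]]
      by simp
    ultimately show ?thesis by (blast intro: pres_eq.trans pres_eq.sym)
  qed
  have a_pos: "?E ((Gen_a, True) # quat_word m) (quat_word (quat_act n (Gen_a, True) m))"
    if m: "m \<in> quat_forms n" for m
  proof -
    obtain i t where i: "m = (i, t)" "0 \<le> i" "i < 2 * int n"
      using m by (auto simp: quat_forms_def)
    show ?thesis
    proof (cases "i + 1 = 2 * int n")
      case True
      \<comment> \<open>Only at the top exponent does the action wrap around, and there
        \<open>a^(2n) = e\<close> is needed.\<close>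
      then have len: "Suc (nat i) = 2 * n" using i by linarith
      have "?E (replicate (2 * n) (Gen_a, True)) []"
        by (rule pres_eq.rel) (simp add: quaternion_relations_def)
      from pres_eq.append[OF this pres_eq.refl[of _ "if t then [(Gen_b, True)] else []"]]
      show ?thesis using i True by (simp add: quat_word_def flip: len)
    next
      case False
      then show ?thesis using i by (simp add: quat_word_def nat_add_distrib pres_eq.refl)
    qed
  qed
  have a_neg: "?E ((Gen_a, False) # quat_word m) (quat_word (quat_act n (Gen_a, False) m))"
    if "m \<in> quat_forms n" for m
    using inverse_letter[of Gen_a True m] a_pos that by simp
  \<comment> \<open>Multiply \<open>b a b^(-1) = a^(-1)\<close> by \<open>b\<close> on the
    right.\<close>
  have ba: "?E [(Gen_b, True), (Gen_a, True)] [(Gen_a, False), (Gen_b, True)]"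
  proof -
    have "?E ([(Gen_b, True), (Gen_a, True), (Gen_b, False)] @ [(Gen_b, True)])
        ([(Gen_a, False)] @ [(Gen_b, True)])"
      by (intro pres_eq.append pres_eq.refl pres_eq.rel) (simp add: quaternion_relations_def)
    moreover have "?E ([(Gen_b, True), (Gen_a, True)] @ [(Gen_b, False), (Gen_b, True)])
        ([(Gen_b, True), (Gen_a, True)] @ [])"
      using pres_eq.cancel[of _ Gen_b False] by (intro pres_eq.append pres_eq.refl) simp
    ultimately show ?thesis by (auto intro: pres_eq.trans pres_eq.sym)
  qed
  \<comment> \<open>Induction on the exponent by \<open>b a^(k+1) = a^(-1) b a^k\<close>; the base
    case with \<open>t\<close> true uses \<open>b^2 = a^n\<close>.\<close>
  have b_pos_nat: "int k < 2 * int n \<Longrightarrow> ?E ((Gen_b, True) # quat_word (int k, t))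
      (quat_word (quat_act n (Gen_b, True) (int k, t)))" for k t
  proof (induction k)
    case 0
    have "?E [(Gen_b, True), (Gen_b, True)] (replicate n (Gen_a, True))"
      by (rule pres_eq.sym, rule pres_eq.rel) (simp add: quaternion_relations_def)
    then show ?case using n by (cases t) (simp_all add: quat_word_def pres_eq.refl)
  next
    case (Suc k)
    let ?m = "quat_act n (Gen_b, True) (int k, t)"
    have "?E ([(Gen_b, True), (Gen_a, True)] @ quat_word (int k, t))
        ([(Gen_a, False), (Gen_b, True)] @ quat_word (int k, t))"
      by (intro pres_eq.append ba pres_eq.refl)
    moreover have "?E ([(Gen_a, False)] @ ((Gen_b, True) # quat_word (int k, t)))
        ([(Gen_a, False)] @ quat_word ?m)"
      using Suc by (intro pres_eq.append pres_eq.refl) simp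
    moreover have "?E ([(Gen_a, False)] @ quat_word ?m)
        (quat_word (quat_act n (Gen_a, False) ?m))"
      using a_neg n by (simp add: quat_act_in_forms)
    moreover have "quat_act n (Gen_a, False) ?m = quat_act n (Gen_b, True) (int (Suc k), t)"
      by (cases t) (simp_all add: mod_simps mod_eq_dvd_iff)
    moreover have "quat_word (int (Suc k), t) = (Gen_a, True) # quat_word (int k, t)"
      by (simp add: quat_word_def nat_add_distrib flip: of_nat_Suc)
    ultimately show ?case by (auto intro: pres_eq.trans)
  qed
  have b_pos: "?E ((Gen_b, True) # quat_word m) (quat_word (quat_act n (Gen_b, True) m))"
    if m: "m \<in> quat_forms n" for m
  proof -
    have "m = (int (nat (fst m)), snd m)" "int (nat (fst m)) < 2 * int n"
      using m by (auto simp: quat_forms_def)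
    with b_pos_nat[of "nat (fst m)" "snd m"] show ?thesis by argo
  qed
  have b_neg: "?E ((Gen_b, False) # quat_word m) (quat_word (quat_act n (Gen_b, False) m))"
    if "m \<in> quat_forms n" for m
    using inverse_letter[of Gen_b True m] b_pos that by simp
  show ?thesis
  proof (cases l)
    case (Pair x s)
    with a_pos[OF m] a_neg[OF m] b_pos[OF m] b_neg[OF m] show ?thesis
      by (cases x; cases s) (simp_all only:)
  qed
qed

lemma pres_eq_quat_word_eval:
  assumes "n > 0"
  shows "pres_eq (quaternion_relations n) u (quat_word (quat_eval n u (0, False)))"
proof (induction u)
  case Nil
  show ?case by (simp add: quat_word_def pres_eq.refl)
next
  case (Cons l u)
  let ?m = "quat_eval n u (0, False)"
  have "?m \<in> quat_forms n"
    using assms by (intro quat_eval_in_forms) (auto simp: quat_forms_def)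
  with assms have "pres_eq (quaternion_relations n) (l # quat_word ?m) (quat_word (quat_act n l ?m))"
    by (rule pres_eq_quat_word_act)
  with pres_eq.append[OF pres_eq.refl[of _ "[l]"] Cons] show ?case
    by (auto intro: pres_eq.trans)
qed

text \<open>This solves the word problem: words with the same value share a normal form. Equality in
  the group is now arithmetic modulo \<open>2n\<close>.\<close>

lemma pres_eq_quaternion_iff:
  assumes "n > 0"
  shows "pres_eq (quaternion_relations n) u v \<longleftrightarrow>
    quat_eval n u (0, False) = quat_eval n v (0, False)"
proof
  assume "pres_eq (quaternion_relations n) u v"
  with assms show "quat_eval n u (0, False) = quat_eval n v (0, False)"
    by (rule pres_eq_imp_quat_eval_eq) (use assms in \<open>simp add: quat_forms_def\<close>)
next
  assume "quat_eval n u (0, False) = quat_eval n v (0, False)"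
  then show "pres_eq (quaternion_relations n) u v"
    using pres_eq_quat_word_eval[OF assms, of u] pres_eq_quat_word_eval[OF assms, of v]
    by (metis pres_eq.sym pres_eq.trans)
qed

lemma bij_betw_quat_forms:
  assumes "n > 0"
  shows "bij_betw (\<lambda>m. pres_class (quaternion_relations n) (quat_word m))
    (quat_forms n) (carrier (generalized_quaternion n))"
proof -
  let ?R = "quaternion_relations n"
  have 0: "(0, False) \<in> quat_forms n" using assms by (simp add: quat_forms_def)
  have "pres_class ?R u \<in> (\<lambda>m. pres_class ?R (quat_word m)) ` quat_forms n" for u
    using pres_eq_quat_word_eval[OF assms, of u] quat_eval_in_forms[OF assms 0, of u]
    by (auto simp: pres_class_eq_iff)
  then show ?thesis
    by (auto simp: bij_betw_def inj_on_def generalized_quaternion_def carrier_presented_group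
        pres_class_eq_iff pres_eq_quaternion_iff[OF assms] quat_eval_quat_word_one[OF assms])
qed

section \<open>Counting commuting pairs\<close>

text \<open>If at least one factor contains \<open>b\<close>, the exponents of \<open>xy\<close> and
  \<open>yx\<close> differ, up to sign, by twice the tested number; congruence modulo
  \<open>2n\<close> thus becomes divisibility by \<open>n\<close>. Two powers of \<open>a\<close>
  always commute.\<close>

definition quat_commute :: "nat \<Rightarrow> int \<times> bool \<Rightarrow> int \<times> bool \<Rightarrow> bool" where
  "quat_commute n x y \<longleftrightarrow>
    (if snd x then if snd y then int n dvd fst x - fst y else int n dvd fst y
     else snd y \<longrightarrow> int n dvd fst x)"

lemma commute_quat_word_iff:
  assumes n: "n > 0" and x: "x \<in> quat_forms n" and y: "y \<in> quat_forms n"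
  defines "h \<equiv> \<lambda>m. pres_class (quaternion_relations n) (quat_word m)"
  shows "h x \<otimes>\<^bsub>generalized_quaternion n\<^esub> h y = h y \<otimes>\<^bsub>generalized_quaternion n\<^esub> h x
    \<longleftrightarrow> quat_commute n x y"
proof -
  have dvd: "(2 * k dvd 2 * d) = (k dvd d)" for k d :: int by simp
  \<comment> \<open>The next three facts cancel the factor 2 in the shapes that
    \<open>mod_eq_dvd_iff\<close> leaves: \<open>b\<close> in one factor, on either side, and
    \<open>b\<close> in both.\<close>
  have dvd1: "(2 * int n dvd j + i - (i - j)) = (int n dvd j)" for i j
    using dvd[of "int n" j] by (simp add: algebra_simps)
  have dvd2: "(2 * int n dvd i - j - (j + i)) = (int n dvd j)" for i j
    using dvd[of "int n" "- j"] by (simp add: algebra_simps)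
  have dvd3: "(2 * int n dvd 2 * i - 2 * j) = (int n dvd i - j)" for i j
    using dvd[of "int n" "i - j"] by (simp add: algebra_simps)
  obtain i s where xi: "x = (i, s)" by (cases x)
  obtain j t where yj: "y = (j, t)" by (cases y)
  have "h x \<otimes>\<^bsub>generalized_quaternion n\<^esub> h y = h y \<otimes>\<^bsub>generalized_quaternion n\<^esub> h x
    \<longleftrightarrow> quat_eval n (quat_word x) y = quat_eval n (quat_word y) x"
    by (simp add: h_def generalized_quaternion_def mult_presented_group pres_class_eq_iff
        pres_eq_quaternion_iff[OF n] quat_eval_quat_word_one n x y)
  also have "\<dots> \<longleftrightarrow> quat_commute n x y"
    using x y n unfolding xi yj
    by (auto simp: quat_eval_quat_word quat_commute_def mod_eq_dvd_iff dvd1 dvd2 dvd3 add.commute)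
  finally show ?thesis .
qed

lemma dvd_iff_less_double:
  fixes k j :: int
  assumes "0 \<le> j" "j < 2 * k"
  shows "k dvd j \<longleftrightarrow> j = 0 \<or> j = k"
proof
  assume "k dvd j"
  then obtain d where d: "j = k * d" ..
  have "0 < k" using assms by simp
  with assms d have "0 \<le> d" "d < 2"
    by (simp_all add: zero_le_mult_iff mult.commute[of k])
  then have "d = 0 \<or> d = 1" by auto
  with d show "j = 0 \<or> j = k" by auto
qed auto

text \<open>The centralizer of \<open>a^i b\<close> is \<open>{e, a^n, a^i b, a^(i+n) b}\<close>. A
  power \<open>a^i\<close> is central if \<open>n\<close> divides \<open>i\<close>; otherwise it
  commutes only with the powers of \<open>a\<close>.\<close>

lemma card_quat_centralizer:
  assumes n: "n > 0" and x: "(i, s) \<in> quat_forms n"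
  shows "card {y \<in> quat_forms n. quat_commute n (i, s) y} =
    (if s then 4 else if int n dvd i then 4 * n else 2 * n)"
proof -
  let ?I = "{0..<2 * int n}"
  have i: "0 \<le> i" "i < 2 * int n" using x by (auto simp: quat_forms_def)
  show ?thesis
  proof (cases s)
    case False
    then have "{y \<in> quat_forms n. quat_commute n (i, s) y} =
        (if int n dvd i then ?I \<times> UNIV else ?I \<times> {False})"
      by (auto simp: quat_forms_def quat_commute_def)
    then show ?thesis using False by (simp add: card_cartesian_product)
  next
    case True
    \<comment> \<open>This is \<open>i + n\<close> reduced modulo \<open>2n\<close>, the only other
      exponent in range congruent to \<open>i\<close> modulo \<open>n\<close>.\<close>
    define i' where "i' = (if i < int n then i + int n else i - int n)"
    have "int n dvd i - j \<longleftrightarrow> j = i \<or> j = i'" if "0 \<le> j" "j < 2 * int n" for j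
      using that i n dvd_iff_less_double[of "\<bar>i - j\<bar>" "int n"] by (auto simp: i'_def)
    then have "{y \<in> quat_forms n. quat_commute n (i, s) y} =
        {(0, False), (int n, False), (i, True), (i', True)}"
      using True i n dvd_iff_less_double[of _ "int n"]
      by (auto simp: quat_forms_def quat_commute_def i'_def)
    then show ?thesis using True n by (simp add: i'_def)
  qed
qed

lemma card_quat_commute:
  assumes n: "n > 0"
  shows "card {(x, y). x \<in> quat_forms n \<and> y \<in> quat_forms n \<and> quat_commute n x y}
    = 4 * n ^ 2 + 12 * n"
proof -
  let ?I = "{0..<2 * int n}"
  let ?Z = "\<lambda>x. {y \<in> quat_forms n. quat_commute n x y}"
  have fin: "finite (quat_forms n)" by (simp add: quat_forms_def)
  have "{(x, y). x \<in> quat_forms n \<and> y \<in> quat_forms n \<and> quat_commute n x y}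
      = Sigma (quat_forms n) ?Z"
    by auto
  then have "card {(x, y). x \<in> quat_forms n \<and> y \<in> quat_forms n \<and> quat_commute n x y}
      = (\<Sum>x\<in>quat_forms n. card (?Z x))"
    using fin by (simp add: card_SigmaI)
  also have "\<dots> = (\<Sum>(i, s)\<in>?I \<times> UNIV. if s then 4 else if int n dvd i then 4 * n else 2 * n)"
  proof (rule sum.cong)
    fix x assume "x \<in> ?I \<times> (UNIV :: bool set)"
    then show "card (?Z x) = (case x of (i, s) \<Rightarrow>
        if s then 4 else if int n dvd i then 4 * n else 2 * n)"
      using card_quat_centralizer[OF n, of "fst x" "snd x"]
      by (cases x) (simp add: quat_forms_def)
  qed (simp add: quat_forms_def)
  also have "\<dots> = (\<Sum>i\<in>?I. 4 + (if int n dvd i then 4 * n else 2 * n))"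
    by (simp add: sum.cartesian_product[symmetric] UNIV_bool add.commute)
  \<comment> \<open>Splitting \<open>4n\<close> as \<open>2n + 2n\<close> isolates an indicator, so
    only the multiples of \<open>n\<close> in range, namely 0 and \<open>n\<close>, remain to be
    counted.\<close>
  also have "\<dots> = (\<Sum>i\<in>?I. (4 + 2 * n) + of_bool (int n dvd i) * (2 * n))"
    by (rule sum.cong) auto
  also have "\<dots> = (4 + 2 * n) * (2 * n) + (\<Sum>i\<in>?I. of_bool (int n dvd i)) * (2 * n)"
    by (simp only: sum.distrib sum_distrib_right) (simp add: nat_mult_distrib algebra_simps)
  also have "(\<Sum>i\<in>?I. of_bool (int n dvd i) :: nat) = card (?I \<inter> {i. int n dvd i})"
    by simp
  also have "?I \<inter> {i. int n dvd i} = {0, int n}"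
    using n by (auto simp: dvd_iff_less_double)
  finally show ?thesis using n by (simp add: power2_eq_square algebra_simps)
qed

section \<open>Transfer to the quaternion group\<close>

theorem theorem6p7:
  fixes n :: nat
  assumes "n > 0"
  shows "wiener_index (ESCom (generalized_quaternion n)) = ereal (14 * real n ^ 2 - 8 * real n)"
proof -
  let ?G = "generalized_quaternion n" and ?M = "quat_forms n"
  define h where "h m = pres_class (quaternion_relations n) (quat_word m)" for m
  let ?C = "{(x, y). x \<in> ?M \<and> y \<in> ?M \<and> quat_commute n x y}"
  have h: "bij_betw h ?M (carrier ?G)"
    unfolding h_def[abs_def] by (rule bij_betw_quat_forms) fact
  have comm: "h x \<otimes>\<^bsub>?G\<^esub> h y = h y \<otimes>\<^bsub>?G\<^esub> h x \<longleftrightarrow> quat_commute n x y"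
    if "x \<in> ?M" "y \<in> ?M" for x y
    unfolding h_def using assms that by (rule commute_quat_word_iff)
  have "group ?G" by (simp add: generalized_quaternion_def group_presented_group)
  have "finite ?M" "card ?M = 4 * n"
    by (simp_all add: quat_forms_def card_cartesian_product)
  with h have fin: "finite (carrier ?G)" and card_G: "card (carrier ?G) = 4 * n"
    by (auto simp: bij_betw_finite dest: bij_betw_same_card)
  \<comment> \<open>The bijection \<open>h\<close> carries the commuting pairs of normal forms onto
    those of the group, so the count \<open>c\<close> carries over.\<close>
  have "{(x, y). x \<in> carrier ?G \<and> y \<in> carrier ?G \<and> x \<otimes>\<^bsub>?G\<^esub> y = y \<otimes>\<^bsub>?G\<^esub> x}
      = map_prod h h ` ?C" (is "?L = _")
  proof (intro equalityI subsetI)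
    fix p assume "p \<in> ?L"
    then obtain x y where "x \<in> ?M" "y \<in> ?M" "p = (h x, h y)"
      "h x \<otimes>\<^bsub>?G\<^esub> h y = h y \<otimes>\<^bsub>?G\<^esub> h x"
      unfolding bij_betw_imp_surj_on[OF h, symmetric] by blast
    with comm show "p \<in> map_prod h h ` ?C"
      by (intro image_eqI[of _ _ "(x, y)"]) (simp_all del: split_paired_All)
  next
    fix p assume "p \<in> map_prod h h ` ?C"
    then obtain x y where "x \<in> ?M" "y \<in> ?M" "p = (h x, h y)" "quat_commute n x y"
      by (force simp del: split_paired_All split_paired_Ex)
    with comm h show "p \<in> ?L"
      by (simp add: bij_betwE del: split_paired_All)
  qed
  moreover have "inj_on (map_prod h h) ?C"
    using h by (auto simp: bij_betw_def inj_on_def)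
  ultimately have "card {(x, y). x \<in> carrier ?G \<and> y \<in> carrier ?G \<and>
      x \<otimes>\<^bsub>?G\<^esub> y = y \<otimes>\<^bsub>?G\<^esub> x} = 4 * n ^ 2 + 12 * n"
    by (simp add: card_image card_quat_commute[OF assms])
  \<comment> \<open>With \<open>m = 4n\<close> and \<open>c = 4n^2 + 12n\<close>, the formula gives
    \<open>16n^2 - (2n^2 + 8n)\<close>.\<close>
  then show ?thesis
    using wiener_index_ESCom[OF \<open>group ?G\<close> fin] by (simp add: card_G power_mult_distrib field_simps)
qed

end
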